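(* Let $G$ be a residually finite group. If every finite quotient of $G$ admits an inverse ambiguous automorphism, then $G$ is abelian.
   Context: A group $G$ is residually finite if the intersection of its normal subgroups of finite index is trivial; a finite quotient of $G$ is a group $G/N$ with $N$ a normal subgroup of finite index. A bijection $f$ of a group $G$ onto itself is called inverse ambiguous if $f^{-1}(x)=f(x)^{-1}$ for every $x\in G$, where $f^{-1}(x)$ is the preimage of $x$ under $f$ and $f(x)^{-1}$ is the group inverse of $f(x)$. An inverse ambiguous automorphism is a group automorphism that is inverse ambiguous. *)

theory Defs
  imports "HOL-Algebra.Coset" "HOL-Algebra.Bij"
begin

definition finite_index_normal :: "('a, 'b) monoid_scheme \<Rightarrow> 'a set \<Rightarrow> bool" where
  "finite_index_normal G N \<longleftrightarrow> N \<lhd> G \<and> finite (rcosets\<^bsub>G\<^esub> N)"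

definition residually_finite :: "('a, 'b) monoid_scheme \<Rightarrow> bool" where
  "residually_finite G \<longleftrightarrow> group G \<and> \<Inter>{N. finite_index_normal G N} = {\<one>\<^bsub>G\<^esub>}"

definition inverse_ambiguous :: "('a, 'b) monoid_scheme \<Rightarrow> ('a \<Rightarrow> 'a) \<Rightarrow> bool" where
  "inverse_ambiguous G f \<longleftrightarrow> bij_betw f (carrier G) (carrier G) \<and>
     (\<forall>x\<in>carrier G. inv_into (carrier G) f x = inv\<^bsub>G\<^esub> (f x))"

end

theory Submission
  imports Defs
begin

text \<open>For an automorphism \<open>f\<close>, inverse ambiguity says that \<open>f \<circ> f\<close> is inversion. Inversion is
  then a homomorphism, which forces commutativity. Hence every commutator of \<open>G\<close> lies in every
  normal subgroup of finite index, and residual finiteness makes it trivial.\<close>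

text \<open>Apply \<open>f\<close> to the identity between the preimage of \<open>x\<close> and
  \<open>inv (f x)\<close>: the left side becomes \<open>x\<close>, and on the right the
  homomorphism \<open>f\<close> moves past the inverse, giving \<open>inv (f (f x))\<close>.\<close>

lemma (in group) inverse_ambiguous_auto_square:
  assumes f: "f \<in> auto G" and ia: "inverse_ambiguous G f" and x: "x \<in> carrier G"
  shows "f (f x) = inv x"
proof -
  have hom: "f \<in> hom G G" and bij: "bij_betw f (carrier G) (carrier G)"
    using f ia by (auto simp: auto_def inverse_ambiguous_def)
  interpret group_hom G G f
    using hom by unfold_locales
  have "f (inv (f x)) = f (inv_into (carrier G) f x)"
    using ia x by (simp add: inverse_ambiguous_def)
  also have "\<dots> = x"
    using bij x by (simp add: bij_betw_inv_into_right)
  finally have "inv (f (f x)) = x"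
    using x by simp
  then show ?thesis
    using x by (metis hom_closed inv_inv)
qed

lemma (in group) inverse_ambiguous_auto_imp_comm_group:
  assumes f: "f \<in> auto G" and ia: "inverse_ambiguous G f"
  shows "comm_group G"
proof (rule group_comm_groupI)
  fix x y assume xy: "x \<in> carrier G" "y \<in> carrier G"
  interpret group_hom G G f
    using f by unfold_locales (simp add: auto_def)
  \<comment> \<open>Replacing each inverse by a double application of \<open>f\<close> reduces this
    to multiplicativity of \<open>f\<close>, used twice.\<close>
  have "inv (x \<otimes> y) = inv x \<otimes> inv y"
    using xy inverse_ambiguous_auto_square[OF f ia, symmetric] by simp
  also have "\<dots> = inv (y \<otimes> x)"
    using xy by (simp add: inv_mult_group)
  finally show "x \<otimes> y = y \<otimes> x"
    using xy by (metis inv_inv m_closed)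
qed

text \<open>The commutator is written as a quotient of the two products because membership in
  \<open>H\<close> is then exactly the statement that \<open>x \<otimes> y\<close> lies in the coset
  of \<open>y \<otimes> x\<close>.\<close>

lemma (in normal) commutator_mem_if_comm_factgroup:
  assumes "comm_group (G Mod H)" and xy: "x \<in> carrier G" "y \<in> carrier G"
  shows "(x \<otimes> y) \<otimes> inv (y \<otimes> x) \<in> H"
proof -
  interpret Q: comm_group "G Mod H" by fact
  have "H #> x \<in> carrier (G Mod H)" "H #> y \<in> carrier (G Mod H)"
    using xy by (simp_all add: carrier_FactGroup)
  then have "H #> (x \<otimes> y) = H #> (y \<otimes> x)"
    using Q.m_comm[of "H #> x" "H #> y"] xy by (simp add: FactGroup_def rcos_sum)
  then have "x \<otimes> y \<in> H #> (y \<otimes> x)"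
    using rcos_self[of "x \<otimes> y" H] xy subgroup_axioms by simp
  then show ?thesis
    using xy by (intro rcos_module_imp) auto
qed

theorem proposition5p6:
  fixes G :: "('a, 'b) monoid_scheme"
  assumes "group G"
    and "residually_finite G"
    and "\<And>N. finite_index_normal G N \<Longrightarrow> \<exists>f \<in> auto (G Mod N). inverse_ambiguous (G Mod N) f"
  shows "comm_group G"
proof -
  interpret group G by fact
  show ?thesis
  proof (rule group_comm_groupI)
    fix x y assume xy: "x \<in> carrier G" "y \<in> carrier G"
    have "(x \<otimes>\<^bsub>G\<^esub> y) \<otimes>\<^bsub>G\<^esub> inv\<^bsub>G\<^esub> (y \<otimes>\<^bsub>G\<^esub> x) \<in> N" if N: "finite_index_normal G N" for N
    proof -
      interpret normal N G
        using N by (simp add: finite_index_normal_def)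
      have "comm_group (G Mod N)"
        using assms(3)[OF N] group.inverse_ambiguous_auto_imp_comm_group[OF factorgroup_is_group]
        by blast
      then show ?thesis
        using xy by (rule commutator_mem_if_comm_factgroup)
    qed
    then have "(x \<otimes>\<^bsub>G\<^esub> y) \<otimes>\<^bsub>G\<^esub> inv\<^bsub>G\<^esub> (y \<otimes>\<^bsub>G\<^esub> x) = \<one>\<^bsub>G\<^esub>"
      using assms(2) unfolding residually_finite_def by blast
    \<comment> \<open>The left factor is a left inverse of the inverse of \<open>yx\<close>;
      uniqueness of inverses identifies it with \<open>yx\<close>.\<close>
    then show "x \<otimes>\<^bsub>G\<^esub> y = y \<otimes>\<^bsub>G\<^esub> x"
      using xy by (metis inv_closed inv_equality inv_inv m_closed)
  qed
qed

end
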